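(* Let $N$ be a real number and let $x,y\ge 2$ be integers. (i) $$f_N(x,x)=x-f_N(0,x)=1-|1+N|.$$ (ii) If $x>y$, then $$f_N(x,y)=\max\{x-f_N(0,y),\;x-y-f_N(y,y)\}=x-y+\bigl|1-|1+N|\bigr|.$$
   Context: Scoring Nim: fix a real number $N$. A position is a tuple $\boldsymbol p=(p_1,\ldots,p_n)$ of non-negative integers (pile sizes), and $|\boldsymbol p|=\sum_i p_i$. Two players alternate; a move $\boldsymbol p\to\boldsymbol p'$ replaces exactly one coordinate $p_i$ by a strictly smaller non-negative integer. A player gets 1 point per stone taken, and the player taking the last stone gets $N$ additional points. The payoff function $f_N$ (score difference, player to move minus opponent, under optimal play) is defined recursively by $f_N(\boldsymbol 0)=-N$ for the terminal position $\boldsymbol 0=(0,\ldots,0)$, and, for $\boldsymbol p\neq\boldsymbol 0$, $f_N(\boldsymbol p)=\max_{\boldsymbol p\to\boldsymbol p'}\{|\boldsymbol p|-|\boldsymbol p'|-f_N(\boldsymbol p')\}$. *)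

theory Defs
  imports Complex_Main
begin

inductive nim_move :: "nat list \<Rightarrow> nat list \<Rightarrow> bool" where
  "i < length p \<Longrightarrow> k < p ! i \<Longrightarrow> nim_move p (p[i := k])"

lemma sum_list_nim_move: "nim_move p q \<Longrightarrow> sum_list q < sum_list p"
proof (induction rule: nim_move.induct)
  case (1 i p k)
  moreover have "p ! i \<le> sum_list p"
    using 1 by (simp add: elem_le_sum_list)
  ultimately show ?case
    by (simp add: sum_list_update)
qed

text \<open>The payoff of a position, for the player to move, with bonus \<open>N\<close> for taking the last
  stone. The set of options is finite, and it is nonempty for every non-terminal position, so
  \<open>Max\<close> is a genuine maximum (\<open>finite_nim_moves\<close> and \<open>ex_nim_move\<close> below).\<close>

function nim_score :: "real \<Rightarrow> nat list \<Rightarrow> real" where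
  "nim_score N p =
     (if p = replicate (length p) 0 then - N
      else Max ((\<lambda>q. real (sum_list p) - real (sum_list q) - nim_score N q) ` {q. nim_move p q}))"
  by pat_completeness auto
termination
  by (relation "measure (\<lambda>(N, p). sum_list p)") (auto intro: sum_list_nim_move)

declare nim_score.simps [simp del]

lemma finite_nim_moves: "finite {q. nim_move p q}"
proof -
  have "{q. nim_move p q} = (\<Union>i<length p. (\<lambda>k. p[i := k]) ` {..<p ! i})"
    by (auto simp: nim_move.simps)
  then show ?thesis
    by simp
qed

lemma ex_nim_move:
  assumes "p \<noteq> replicate (length p) 0"
  shows "\<exists>q. nim_move p q"
proof -
  obtain i where "i < length p" "p ! i \<noteq> 0"
    using assms by (metis length_replicate nth_equalityI nth_replicate)
  then show ?thesis
    using nim_move.intros[of i p 0] by blast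
qed

end

theory Submission
  imports Defs
begin

text \<open>All values follow by induction from \<open>f(0, 1) = 1 + N\<close> and \<open>f(1, 1) = - N\<close>: for
  \<open>x \<ge> 2\<close> one gets \<open>f(0, x) = x - 1 + \<bar>1 + N\<bar>\<close> by leaving 0 or 1 stones and
  \<open>f(1, x) = x - 1 + \<bar>N\<bar>\<close> by leaving \<open>(1, 0)\<close> or \<open>(1, 1)\<close>.
  Put \<open>c = 1 - \<bar>1 + N\<bar>\<close>. With both piles at least 2, an equal pair has value \<open>c\<close>, by removing a
  whole pile. From an unequal pair the larger pile \<open>x\<close> is either removed or cut down
  to the smaller one \<open>y\<close>, which yields \<open>x - y + c\<close> or \<open>x - y - c\<close>; no other move
  does better.\<close>

lemma nim_moves_pair:
  "{q. nim_move [a, b] q} = (\<lambda>k. [k, b]) ` {..<a} \<union> (\<lambda>k. [a, k]) ` {..<b}"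
proof -
  have "{q. nim_move [a, b] q} =
      (\<Union>i<length [a, b]. (\<lambda>k. [a, b][i := k]) ` {..<[a, b] ! i})"
    unfolding nim_move.simps by blast
  then show ?thesis
    by (simp add: lessThan_Suc Un_commute)
qed

lemma nim_score_pair:
  assumes "0 < a + b"
  shows "nim_score N [a, b] =
    Max ((\<lambda>k. real a - real k - nim_score N [k, b]) ` {..<a} \<union>
         (\<lambda>k. real b - real k - nim_score N [a, k]) ` {..<b})"
proof -
  have "[a, b] \<noteq> replicate (length [a, b]) 0"
    using assms by auto
  then have "nim_score N [a, b] =
      Max ((\<lambda>q. real (sum_list [a, b]) - real (sum_list q) - nim_score N q) `
        {q. nim_move [a, b] q})"
    by (subst nim_score.simps) (simp only: if_False)
  then show ?thesis
    by (simp add: nim_moves_pair image_Un image_image)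
qed

text \<open>Splits the maximum into a bound on all options and one option that attains it. The
  attaining option also shows that the position is not terminal.\<close>

lemma nim_score_pair_eqI:
  assumes "\<And>k. k < a \<Longrightarrow> real a - real k - nim_score N [k, b] \<le> v"
    and "\<And>k. k < b \<Longrightarrow> real b - real k - nim_score N [a, k] \<le> v"
    and attained: "(\<exists>k<a. real a - real k - nim_score N [k, b] = v) \<or>
      (\<exists>k<b. real b - real k - nim_score N [a, k] = v)"
  shows "nim_score N [a, b] = v"
proof -
  have "0 < a + b"
    using attained by auto
  then show ?thesis
    unfolding nim_score_pair[OF \<open>0 < a + b\<close>] using assms by (intro Max_eqI) auto
qed

lemma nim_score_zero_zero [simp]: "nim_score N [0, 0] = - N"
  by (subst nim_score.simps) simp

text \<open>Swapping the piles swaps the two families of options. Moves in the second pile can thus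
  be reduced to moves in the first.\<close>

lemma nim_score_pair_commute: "nim_score N [a, b] = nim_score N [b, a]"
proof (induction "a + b" arbitrary: a b rule: less_induct)
  case less
  show ?case
  proof (cases "a + b = 0")
    case False
    then have pos: "0 < a + b" "0 < b + a"
      by auto
    have "(\<lambda>k. real a - real k - nim_score N [k, b]) ` {..<a} =
        (\<lambda>k. real a - real k - nim_score N [b, k]) ` {..<a}"
      using less by (intro image_cong) auto
    moreover have "(\<lambda>k. real b - real k - nim_score N [a, k]) ` {..<b} =
        (\<lambda>k. real b - real k - nim_score N [k, a]) ` {..<b}"
      using less by (intro image_cong) auto
    ultimately show ?thesis
      unfolding nim_score_pair[OF pos(1)] nim_score_pair[OF pos(2)] by (simp add: Un_commute)
  qed simp
qed

lemma nim_score_zero_one: "nim_score N [0, 1] = 1 + N"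
  by (rule nim_score_pair_eqI) auto

lemma nim_score_one_one: "nim_score N [1, 1] = - N"
  using nim_score_zero_one[of N] nim_score_pair_commute[of N 1 0]
  by (intro nim_score_pair_eqI) auto

text \<open>Leaving 0 or 1 stones yields \<open>x - 1\<close> plus or minus \<open>1 + N\<close>,
  whence the absolute value. Leaving \<open>k \<ge> 2\<close> yields at most
  \<open>x - 3\<close>.\<close>

lemma nim_score_zero_left:
  assumes "2 \<le> x"
  shows "nim_score N [0, x] = real x - 1 + \<bar>1 + N\<bar>"
  using assms
proof (induction x rule: less_induct)
  case (less x)
  show ?case
  proof (rule nim_score_pair_eqI)
    fix k assume "k < x"
    then consider "k = 0" | "k = 1" | "2 \<le> k" by linarith
    then show "real x - real k - nim_score N [0, k] \<le> real x - 1 + \<bar>1 + N\<bar>"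
      using less.IH[of k] nim_score_zero_one[of N] \<open>k < x\<close>
      by cases (auto simp: abs_if)
  next
    have "real x - real 0 - nim_score N [0, 0] = real x - 1 + \<bar>1 + N\<bar> \<or>
        real x - real 1 - nim_score N [0, 1] = real x - 1 + \<bar>1 + N\<bar>"
      unfolding nim_score_zero_one by simp linarith
    then show "(\<exists>k<0. real 0 - real k - nim_score N [k, x] = real x - 1 + \<bar>1 + N\<bar>) \<or>
        (\<exists>k<x. real x - real k - nim_score N [0, k] = real x - 1 + \<bar>1 + N\<bar>)"
      using \<open>2 \<le> x\<close> by (metis less_le_trans one_less_numeral_iff pos2 semiring_norm(76))
  qed simp
qed

lemma nim_score_one_left:
  assumes "2 \<le> x"
  shows "nim_score N [1, x] = real x - 1 + \<bar>N\<bar>"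
  using assms
proof (induction x rule: less_induct)
  case (less x)
  have one_zero: "nim_score N [1, 0] = 1 + N"
    using nim_score_zero_one nim_score_pair_commute by metis
  show ?case
  proof (rule nim_score_pair_eqI)
    \<comment> \<open>Taking the single stone yields \<open>2 - x - \<bar>1 + N\<bar>\<close>, which
      is at most 0.\<close>
    fix k assume "k < (1::nat)"
    then show "real 1 - real k - nim_score N [k, x] \<le> real x - 1 + \<bar>N\<bar>"
      using \<open>2 \<le> x\<close> nim_score_zero_left[of x N] by simp
  next
    fix k assume "k < x"
    then consider "k = 0" | "k = 1" | "2 \<le> k" by linarith
    then show "real x - real k - nim_score N [1, k] \<le> real x - 1 + \<bar>N\<bar>"
      using less.IH[of k] nim_score_one_one[of N] one_zero \<open>k < x\<close> by cases auto
  next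
    have "real x - real 0 - nim_score N [1, 0] = real x - 1 + \<bar>N\<bar> \<or>
        real x - real 1 - nim_score N [1, 1] = real x - 1 + \<bar>N\<bar>"
      unfolding one_zero nim_score_one_one by simp linarith
    then show "(\<exists>k<1. real 1 - real k - nim_score N [k, x] = real x - 1 + \<bar>N\<bar>) \<or>
        (\<exists>k<x. real x - real k - nim_score N [1, k] = real x - 1 + \<bar>N\<bar>)"
      using \<open>2 \<le> x\<close> by (metis less_le_trans one_less_numeral_iff pos2 semiring_norm(76))
  qed
qed

text \<open>The symmetric form covers both orders of the piles. The induction needs this, since a
  move can make the larger pile the smaller one.\<close>

lemma nim_score_large_pair:
  assumes "2 \<le> x" and "2 \<le> y"
  shows "nim_score N [x, y] =
    (if x = y then 1 - \<bar>1 + N\<bar> else \<bar>real x - real y\<bar> + \<bar>1 - \<bar>1 + N\<bar>\<bar>)"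
proof -
  define c where "c = 1 - \<bar>1 + N\<bar>"
  define v where "v x y = (if x = y then c else \<bar>real x - real y\<bar> + \<bar>c\<bar>)" for x y :: nat
  \<comment> \<open>The first bound is the triangle inequality for \<open>1 + N\<close>. Both serve
    the move to \<open>[1, y]\<close>, which yields \<open>x - y - \<bar>N\<bar>\<close>.\<close>
  have c_ge: "- \<bar>N\<bar> \<le> c" "- \<bar>N\<bar> \<le> \<bar>c\<bar>"
    unfolding c_def by linarith+
  have zero: "nim_score N [0, z] = real z - c" if "2 \<le> z" for z
    using nim_score_zero_left[OF that] by (simp add: c_def)
  have "nim_score N [x, y] = v x y"
    using assms
  proof (induction "x + y" arbitrary: x y rule: less_induct)
    case less
    \<comment> \<open>Stated for arbitrary piles so that, after a swap, it also bounds the moves in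
      the second pile.\<close>
    have bound: "real x - real k - nim_score N [k, y] \<le> v x y"
      if "k < x" "2 \<le> x" "2 \<le> y" and IH: "2 \<le> k \<Longrightarrow> nim_score N [k, y] = v k y" for k x y
    proof -
      consider "k = 0" | "k = 1" | "2 \<le> k" by linarith
      then show ?thesis
      proof cases
        case 1
        then show ?thesis
          using zero[of y] that abs_ge_self[of "real x - real y"] abs_ge_self[of c]
          by (simp add: v_def)
      next
        case 2
        then show ?thesis
          using nim_score_one_left[of y N] that c_ge abs_ge_self[of "real x - real y"]
          by (simp add: v_def)
      next
        \<comment> \<open>For \<open>k = y\<close> the option yields \<open>x - y - c\<close>.
          Otherwise \<open>x - k - \<bar>k - y\<bar> \<le> x - y\<close>, and
          \<open>- \<bar>c\<bar>\<close> is at most both \<open>c\<close> and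
          \<open>\<bar>c\<bar>\<close>.\<close>
        case 3
        then show ?thesis
          using IH \<open>k < x\<close> by (auto simp: v_def)
      qed
    qed
    have v_commute: "v a b = v b a" for a b
      by (simp add: v_def abs_minus_commute)
    have attained: "\<exists>k<x. real x - real k - nim_score N [k, y] = v x y"
      if "y \<le> x" "2 \<le> y" and IH: "y < x \<Longrightarrow> nim_score N [y, y] = v y y" for x y
    \<comment> \<open>Removing the pile yields \<open>x - y + c\<close>. If \<open>c < 0\<close> and
      \<open>y < x\<close>, cutting it to \<open>y\<close> yields \<open>x - y - c\<close>
      instead.\<close>
    proof (cases "y = x \<or> 0 \<le> c")
      case True
      then show ?thesis
        using zero[of y] that by (intro exI[of _ 0]) (auto simp: v_def)
    next
      case False
      then show ?thesis
        using that by (intro exI[of _ y]) (auto simp: v_def)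
    qed
    show ?case
    proof (rule nim_score_pair_eqI)
      fix k assume "k < x"
      then show "real x - real k - nim_score N [k, y] \<le> v x y"
        using less by (intro bound) auto
    next
      fix k assume "k < y"
      then have "real y - real k - nim_score N [k, x] \<le> v y x"
        using less by (intro bound) auto
      then show "real y - real k - nim_score N [x, k] \<le> v x y"
        by (simp add: nim_score_pair_commute[of N x] v_commute)
    next
      show "(\<exists>k<x. real x - real k - nim_score N [k, y] = v x y) \<or>
          (\<exists>k<y. real y - real k - nim_score N [x, k] = v x y)"
      proof (cases "y \<le> x")
        case True
        then show ?thesis
          using less by (intro disjI1 attained) auto
      next
        case False
        then have "\<exists>k<y. real y - real k - nim_score N [k, x] = v y x"
          using less by (intro attained) auto
        then show ?thesis
          by (simp add: nim_score_pair_commute[of N x] v_commute)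
      qed
    qed
  qed
  then show ?thesis
    by (simp add: v_def c_def)
qed

theorem proposition4:
  fixes N :: real and x y :: nat
  assumes "x \<ge> 2" and "y \<ge> 2"
  shows "nim_score N [x, x] = real x - nim_score N [0, x]
       \<and> real x - nim_score N [0, x] = 1 - \<bar>1 + N\<bar>
       \<and> (x > y \<longrightarrow>
            nim_score N [x, y] = max (real x - nim_score N [0, y]) (real x - real y - nim_score N [y, y])
          \<and> max (real x - nim_score N [0, y]) (real x - real y - nim_score N [y, y])
              = real x - real y + \<bar>1 - \<bar>1 + N\<bar>\<bar>)"
  \<comment> \<open>With \<open>c = 1 - \<bar>1 + N\<bar>\<close>, the two arguments of
    \<open>max\<close> are \<open>x - y + c\<close> and \<open>x - y - c\<close>.\<close>
  using nim_score_zero_left[of x N] nim_score_zero_left[of y N]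
    nim_score_large_pair[of x x N] nim_score_large_pair[of y y N] nim_score_large_pair[of x y N] assms
  by (auto simp: max_def abs_if)

end
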